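(* Let $m\ge1$ be an integer and suppose $R_0\in(\gamma_m,\beta_m]$. Let $x_e$ and $\hat x_e$ be the Nash equilibrium threshold values in the non-reneging case and in the reneging case, respectively. Then $$\hat z^{(\hat x_e,\hat x_e)}_{i,i}<z^{(x_e)}_{i,i},\qquad i=1,\ldots,m.$$ Furthermore, the total expected payoffs under equilibrium satisfy $$\sum_{i=1}^{m+1}\hat\pi^{(\hat x_e)}_{i-1}\,\hat z^{(\hat x_e,\hat x_e)}_{i,i}<\sum_{i=1}^{m}\pi^{(x_e)}_{i-1}\,z^{(x_e)}_{i,i}.$$
   Context: Parameters $\lambda,\mu>0$, $0<q<1$, $R_0>0$. Single-server first-come-first-served queue: Poisson arrivals of rate $\lambda$, i.i.d. exponential($\mu$) services. After each service a customer departs successfully with probability $q$ (reward $R_0$); otherwise the service fails and she immediately goes to the end of the queue. An arriving customer who sees $j-1$ customers in the system may join, taking position $j$ (position 1 is in service), or balk (payoff 0). Waiting costs 1 per unit time. Threshold strategy: for $x\ge 0$, with $n=\lfloor x\rfloor$ and $p=x-n$: $u^{(x)}(i)=1$ if $i\le n$, $u^{(x)}(n+1)=p$, $u^{(x)}(i)=0$ if $i\ge n+2$. Non-reneging case ($N$-case): a customer with threshold $x$ joins at position $i$ with probability $u^{(x)}(i)$ and then stays until success. For $1\le i\le j\le\lceil x\rceil+1$, $w^{(x)}_{i,j}$ is the expected remaining time in the system of a tagged customer in position $i$ with $j$ customers in the system, all others using threshold $x$; it is the unique solution of $$(\lambda+\mu)w_{i,j}=1+\lambda\left[u^{(x)}(j+1)w_{i,j+1}+(1-u^{(x)}(j+1))w_{i,j}\right]+\mu\,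 s_{i,j},$$ with $s_{1,j}=(1-q)w_{j,j}$ and $s_{i,j}=q\,w_{i-1,j-1}+(1-q)\,w_{i-1,j}$ for $i>1$ (terms with zero coefficient are omitted). Put $z^{(x)}_{i,j}=R_0-w^{(x)}_{i,j}$ and, for $m\ge1$, $\alpha_m=w^{(m)}_{m,m}$, $\beta_m=w^{(m)}_{m+1,m+1}$. The $N$-case Nash equilibrium threshold is $x_e=m$ when $\alpha_m\le R_0\le\beta_m$; in particular $x_e=m$ when $R_0\in(\gamma_m,\beta_m]$. Reneging case ($R$-case): in addition, a customer with threshold $x$ whose service fails, and who would be in position $i$ at the end of the queue, stays with probability $u^{(x)}(i)$ and otherwise leaves without reward. For others' threshold $x$ with $n=\lfloor x\rfloor$ and tagged customer's threshold $x_{tag}\in[n,n+1]$, $\hat z^{(x_{tag},x)}_{i,j}$ ($1\le i\le j\le n+1$) is the tagged customer's expected future payoff (reward minus waiting cost) when she is in position $i$ and $j$ customers are in the system; it is the unique solution of $$(\lambda+\mu)\hat z_{i,j}=-1+\lambda\left[u^{(x)}(j+1)\hat z_{i,j+1}+(1-u^{(x)}(j+1))\hat z_{i,j}\right]+\mu\,\hat s_{i,j},$$ with $\hat s_{1,j}=qR_0+(1-q)u^{(x_{tag})}(j)\hat z_{j,j}$ and $\hat s_{i,j}=\left[q+(1-q)(1-u^{(x)}(j))\right]\hat z_{i-1,j-1}+(1-q)u^{(x)}(j)\hat z_{i-1,j}$ for $i>1$. When $x_{tag}=n+1$ the tagged customer never reneges, and $\hat w^{(n+1,x)}_{i,j}=R_0-\hat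 z^{(n+1,x)}_{i,j}$ is her expected remaining time in the system (independent of $R_0$). For $m\ge 1$, $\gamma_m=\hat w^{(m+1,m)}_{m+1,m+1}$. When $R_0\in(\gamma_m,\beta_m]$, the $R$-case Nash equilibrium threshold $\hat x_e$ is the $x\in(m,m+1)$ with $\hat z^{(m+1,x)}_{m+1,m+1}=0$. Stationary distributions of the number of customers when everyone uses threshold $x$: $\pi^{(x)}$ ($N$-case) is that of the birth-death chain with birth rate $\lambda u^{(x)}(j+1)$ in state $j\ge0$ and death rate $\mu q$ in states $j\ge1$; $\hat\pi^{(x)}$ ($R$-case) is that of the birth-death chain with birth rate $\lambda u^{(x)}(j+1)$ in state $j\ge 0$ and death rate $\mu q+\mu(1-q)(1-u^{(x)}(j))$ in states $j\ge1$ (both supported on $\{0,\ldots,\lceil x\rceil\}$). *)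

theory Defs
  imports Complex_Main
begin

(* Customers' positions and system sizes are natural numbers >= 1 (position 1 is in service);
   thresholds are reals >= 0. *)

definition join_prob :: "real \<Rightarrow> nat \<Rightarrow> real" where
  "join_prob x i =
     (if int i \<le> \<lfloor>x\<rfloor> then 1 else if int i = \<lfloor>x\<rfloor> + 1 then x - of_int \<lfloor>x\<rfloor> else 0)"

(* Pairs (position, system size) with system size at most N. *)
definition states :: "nat \<Rightarrow> (nat \<times> nat) set" where
  "states N = {(i, j). 1 \<le> i \<and> i \<le> j \<and> j \<le> N}"

section \<open>Non-reneging case\<close>

definition N_succ :: "real \<Rightarrow> (nat \<Rightarrow> nat \<Rightarrow> real) \<Rightarrow> nat \<Rightarrow> nat \<Rightarrow> real" where
  "N_succ q w i j =
     (if i = 1 then (1 - q) * w j j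
      else q * w (i - 1) (j - 1) + (1 - q) * w (i - 1) j)"

(* At the largest j the coefficient of w i (j + 1) vanishes, so only values on the state set
   enter the system; values off the state set are normalised to 0 to make the solution unique
   as a total function. *)
definition N_system :: "real \<Rightarrow> real \<Rightarrow> real \<Rightarrow> real \<Rightarrow> (nat \<Rightarrow> nat \<Rightarrow> real) \<Rightarrow> bool" where
  "N_system lam mu q x w \<longleftrightarrow>
     (\<forall>(i, j) \<in> states (nat \<lceil>x\<rceil> + 1).
        (lam + mu) * w i j =
          1 + lam * (join_prob x (j + 1) * w i (j + 1) + (1 - join_prob x (j + 1)) * w i j)
            + mu * N_succ q w i j) \<and>
     (\<forall>i j. (i, j) \<notin> states (nat \<lceil>x\<rceil> + 1) \<longrightarrow> w i j = 0)"

definition N_time :: "real \<Rightarrow> real \<Rightarrow> real \<Rightarrow> real \<Rightarrow> nat \<Rightarrow> nat \<Rightarrow> real" where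
  "N_time lam mu q x = (THE w. N_system lam mu q x w)"

definition N_payoff :: "real \<Rightarrow> real \<Rightarrow> real \<Rightarrow> real \<Rightarrow> real \<Rightarrow> nat \<Rightarrow> nat \<Rightarrow> real" where
  "N_payoff lam mu q R0 x i j = R0 - N_time lam mu q x i j"

definition alpha :: "real \<Rightarrow> real \<Rightarrow> real \<Rightarrow> nat \<Rightarrow> real" where
  "alpha lam mu q m = N_time lam mu q (real m) m m"

definition beta :: "real \<Rightarrow> real \<Rightarrow> real \<Rightarrow> nat \<Rightarrow> real" where
  "beta lam mu q m = N_time lam mu q (real m) (m + 1) (m + 1)"

(* The Nash equilibrium threshold at those rewards R0 for which it is a positive integer. *)
definition N_equilibrium :: "real \<Rightarrow> real \<Rightarrow> real \<Rightarrow> real \<Rightarrow> real \<Rightarrow> bool" where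
  "N_equilibrium lam mu q R0 x \<longleftrightarrow>
     (\<exists>k::nat. 1 \<le> k \<and> x = real k \<and> alpha lam mu q k \<le> R0 \<and> R0 \<le> beta lam mu q k)"

section \<open>Reneging case\<close>

(* y is the tagged customer's threshold, x that of all others. *)
definition R_succ ::
  "real \<Rightarrow> real \<Rightarrow> real \<Rightarrow> real \<Rightarrow> (nat \<Rightarrow> nat \<Rightarrow> real) \<Rightarrow> nat \<Rightarrow> nat \<Rightarrow> real" where
  "R_succ q R0 y x z i j =
     (if i = 1 then q * R0 + (1 - q) * join_prob y j * z j j
      else (q + (1 - q) * (1 - join_prob x j)) * z (i - 1) (j - 1)
           + (1 - q) * join_prob x j * z (i - 1) j)"

definition R_system ::
  "real \<Rightarrow> real \<Rightarrow> real \<Rightarrow> real \<Rightarrow> real \<Rightarrow> real \<Rightarrow> (nat \<Rightarrow> nat \<Rightarrow> real) \<Rightarrow> bool" where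
  "R_system lam mu q R0 y x z \<longleftrightarrow>
     (\<forall>(i, j) \<in> states (nat \<lfloor>x\<rfloor> + 1).
        (lam + mu) * z i j =
          - 1 + lam * (join_prob x (j + 1) * z i (j + 1) + (1 - join_prob x (j + 1)) * z i j)
            + mu * R_succ q R0 y x z i j) \<and>
     (\<forall>i j. (i, j) \<notin> states (nat \<lfloor>x\<rfloor> + 1) \<longrightarrow> z i j = 0)"

(* Meaningful for \<lfloor>x\<rfloor> \<le> y \<le> \<lfloor>x\<rfloor> + 1. *)
definition R_payoff ::
  "real \<Rightarrow> real \<Rightarrow> real \<Rightarrow> real \<Rightarrow> real \<Rightarrow> real \<Rightarrow> nat \<Rightarrow> nat \<Rightarrow> real" where
  "R_payoff lam mu q R0 y x = (THE z. R_system lam mu q R0 y x z)"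

(* Remaining time of a tagged customer who never reneges (threshold \<lfloor>x\<rfloor> + 1).
   R0 is an argument only because it occurs in R_payoff; it cancels. *)
definition R_time :: "real \<Rightarrow> real \<Rightarrow> real \<Rightarrow> real \<Rightarrow> real \<Rightarrow> nat \<Rightarrow> nat \<Rightarrow> real" where
  "R_time lam mu q R0 x i j = R0 - R_payoff lam mu q R0 (of_int \<lfloor>x\<rfloor> + 1) x i j"

definition gamma :: "real \<Rightarrow> real \<Rightarrow> real \<Rightarrow> real \<Rightarrow> nat \<Rightarrow> real" where
  "gamma lam mu q R0 m = R_time lam mu q R0 (real m) (m + 1) (m + 1)"

(* The Nash equilibrium threshold at those rewards R0 that lie in some interval
   (gamma k, beta k]. *)
definition R_equilibrium :: "real \<Rightarrow> real \<Rightarrow> real \<Rightarrow> real \<Rightarrow> real \<Rightarrow> bool" where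
  "R_equilibrium lam mu q R0 x \<longleftrightarrow>
     (\<exists>k::nat. 1 \<le> k \<and> gamma lam mu q R0 k < R0 \<and> R0 \<le> beta lam mu q k \<and>
        real k < x \<and> x < real (k + 1) \<and>
        R_payoff lam mu q R0 (real (k + 1)) x (k + 1) (k + 1) = 0)"

section \<open>Stationary distributions\<close>

(* Global balance equations of the birth-death chain with birth rates b 0, b 1, ... and
   death rates d 1, d 2, ...; the value d 0 is not used. *)
definition stationary_bd :: "(nat \<Rightarrow> real) \<Rightarrow> (nat \<Rightarrow> real) \<Rightarrow> (nat \<Rightarrow> real) \<Rightarrow> bool" where
  "stationary_bd b d p \<longleftrightarrow>
     (\<forall>j. 0 \<le> p j) \<and> p sums 1 \<and>
     b 0 * p 0 = d 1 * p 1 \<and>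
     (\<forall>j\<ge>1. (b j + d j) * p j = b (j - 1) * p (j - 1) + d (j + 1) * p (j + 1))"

definition N_stationary :: "real \<Rightarrow> real \<Rightarrow> real \<Rightarrow> real \<Rightarrow> nat \<Rightarrow> real" where
  "N_stationary lam mu q x =
     (THE p. stationary_bd (\<lambda>j. lam * join_prob x (j + 1)) (\<lambda>j. mu * q) p)"

definition R_stationary :: "real \<Rightarrow> real \<Rightarrow> real \<Rightarrow> real \<Rightarrow> nat \<Rightarrow> real" where
  "R_stationary lam mu q x =
     (THE p. stationary_bd (\<lambda>j. lam * join_prob x (j + 1))
        (\<lambda>j. mu * q + mu * (1 - q) * (1 - join_prob x j)) p)"

end

theory Submission
  imports Defs
begin

text \<open>
  At the reneging equilibrium \<open>xhat\<close> a customer who would have to rejoin at position \<open>m + 1\<close> has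
  continuation payoff 0, so her payoff is the same whether she stays there or leaves.  She may
  therefore be treated as someone who never reneges, and \<open>R0\<close> minus her payoff becomes an expected
  sojourn time.  The non-reneging quantity is also a sojourn time, namely the one in a queue in
  which nobody joins at position \<open>m + 1\<close>.  Both are instances of one linear system, with arrival
  rate \<open>b j\<close> and probability \<open>r j\<close> that a served other customer leaves when \<open>j\<close> customers are present.

  The engine is monotonicity: the sojourn time increases strictly with the number of customers
  present (\<open>sojourn_strict_mono_in_size\<close>), and by at least one service time \<open>1 / mu\<close> along the
  diagonal (\<open>sojourn_diagonal_gap\<close>).  It is proved for the time up to the \<open>n\<close>-th own service of the
  tagged customer, by induction on \<open>n\<close>, and passes to the limit.  Two consequences follow.

  First, the two equilibrium queues differ, as far as sizes up to \<open>m\<close> are concerned, only in that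
  the reneging queue has a positive arrival rate at size \<open>m\<close>; such an arrival delays the tagged
  customer, so her sojourn time is strictly longer (\<open>blocking_shortens_sojourn\<close>).  This is the
  claimed inequality between the payoffs.  The same lemma shows
  \<open>beta k < alpha (k + 1)\<close>, and \<open>alpha k < gamma k\<close> because under threshold \<open>k\<close> a customer in position
  \<open>k + 1\<close> waits for one service and is then in position \<open>k\<close> of \<open>k\<close>.  Hence the intervals
  \<open>[alpha k, beta k]\<close> are disjoint and both equilibria belong to the given \<open>m\<close>.

  Second, the diagonal gap together with payoff 0 at \<open>(m + 1, m + 1)\<close> makes all equilibrium payoffs
  at \<open>(i, i)\<close>, \<open>i \<le> m\<close>, positive in the reneging queue.  Both stationary distributions have the
  same ratios on \<open>{0..m}\<close>, but the reneging one also charges \<open>m + 1\<close>, so it is smaller on \<open>{0..m}\<close> by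
  a constant factor.  Smaller weights on positive and smaller payoffs give a smaller total.
\<close>

section \<open>The sojourn time of a customer who never reneges\<close>

definition after_service ::
  "(nat \<Rightarrow> real) \<Rightarrow> (nat \<Rightarrow> real) \<Rightarrow> (nat \<Rightarrow> nat \<Rightarrow> real) \<Rightarrow> nat \<Rightarrow> nat \<Rightarrow> real" where
  "after_service r g w i j =
     (if i = 1 then g j else r j * w (i - 1) (j - 1) + (1 - r j) * w (i - 1) j)"

text \<open>
  The value \<open>g j\<close> that remains after an own service at size \<open>j\<close> is kept as data, separate from the
  unknown \<open>w\<close>.  With \<open>g\<close> given, the system is triangular in the position, which allows induction;
  the sojourn time is its fixed point, \<open>g j = (1 - q) * w j j\<close>.
\<close>

definition cycle_system ::
  "nat \<Rightarrow> (nat \<Rightarrow> real) \<Rightarrow> (nat \<Rightarrow> real) \<Rightarrow> real \<Rightarrow> (nat \<Rightarrow> real) \<Rightarrow> (nat \<Rightarrow> nat \<Rightarrow> real) \<Rightarrow> bool" where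
  "cycle_system N b r mu g w \<longleftrightarrow>
     (\<forall>(i, j) \<in> states N.
        (b j + mu) * w i j = 1 + b j * w i (j + 1) + mu * after_service r g w i j)"

abbreviation sojourn ::
  "nat \<Rightarrow> (nat \<Rightarrow> real) \<Rightarrow> (nat \<Rightarrow> real) \<Rightarrow> real \<Rightarrow> real \<Rightarrow> (nat \<Rightarrow> nat \<Rightarrow> real) \<Rightarrow> bool" where
  "sojourn N b r mu q w \<equiv> cycle_system N b r mu (\<lambda>j. (1 - q) * w j j) w"

lemma states_iff [simp]: "(i, j) \<in> states N \<longleftrightarrow> 1 \<le> i \<and> i \<le> j \<and> j \<le> N"
  by (simp add: states_def)

lemma cycle_systemD:
  assumes "cycle_system N b r mu g w" "1 \<le> i" "i \<le> j" "j \<le> N"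
  shows "(b j + mu) * w i j = 1 + b j * w i (j + 1) + mu * after_service r g w i j"
  using assms by (auto simp: cycle_system_def)

lemma cycle_system_restrict:
  assumes "cycle_system N b r mu g w" "M \<le> N"
    and "\<And>j. 1 \<le> j \<Longrightarrow> j \<le> M \<Longrightarrow> b' j = b j" "\<And>j. 1 \<le> j \<Longrightarrow> j \<le> M \<Longrightarrow> r' j = r j"
  shows "cycle_system M b' r' mu g w"
  unfolding cycle_system_def
proof clarify
  fix i j assume "(i, j) \<in> states M"
  then have "1 \<le> i" "i \<le> j" "j \<le> M" "1 \<le> j" by auto
  then show "(b' j + mu) * w i j = 1 + b' j * w i (j + 1) + mu * after_service r' g w i j"
    using cycle_systemD[OF assms(1), of i j] assms(2-4) by (simp add: after_service_def)
qed

locale tagged_queue =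
  fixes N :: nat and b r :: "nat \<Rightarrow> real" and mu q :: real
  assumes b_nonneg: "0 \<le> b j" and b_top: "b N = 0"
    and r_pos: "0 < r j" and r_le: "r j \<le> 1"
    and mu_pos: "0 < mu" and q_pos: "0 < q" and q_less: "q < 1"
begin

lemma rate_pos: "0 < b j + mu"
  using b_nonneg[of j] mu_pos by linarith

text \<open>
  A minimum principle for one cycle: every state leads, through positions \<open>i - 1\<close> and sizes \<open>j + 1\<close>,
  to an own service, so a lower bound on what follows an own service is a lower bound everywhere.
  The nested induction goes up in the position and down in the size.
\<close>

lemma lower_bound:
  assumes super: "\<And>i j. 1 \<le> i \<Longrightarrow> i \<le> j \<Longrightarrow> j \<le> N \<Longrightarrow>
      b j * D i (j + 1) + mu * after_service r g D i j \<le> (b j + mu) * D i j"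
    and g: "\<And>j. 1 \<le> j \<Longrightarrow> j \<le> N \<Longrightarrow> c \<le> g j"
    and "1 \<le> i" "i \<le> j" "j \<le> N"
  shows "c \<le> D i j"
  using assms(3-)
proof (induction i arbitrary: j)
  case 0
  then show ?case by simp
next
  case (Suc i)
  have after: "c \<le> after_service r g D (Suc i) j'" if j': "Suc i \<le> j'" "j' \<le> N" for j'
  proof (cases "i = 0")
    case True
    then show ?thesis using g j' by (simp add: after_service_def)
  next
    case False
    then have "c \<le> D i (j' - 1)" "c \<le> D i j'"
      using Suc.IH[of "j' - 1"] Suc.IH[of j'] j' by auto
    then have "r j' * c + (1 - r j') * c \<le> r j' * D i (j' - 1) + (1 - r j') * D i j'"
      using r_pos[of j'] r_le[of j'] by (intro add_mono mult_left_mono) auto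
    then show ?thesis using False by (simp add: after_service_def algebra_simps)
  qed
  from \<open>j \<le> N\<close> \<open>Suc i \<le> j\<close> show ?case
  proof (induction rule: inc_induct)
    case base
    have "mu * c \<le> mu * after_service r g D (Suc i) N"
      using after[of N] base mu_pos by simp
    also have "\<dots> \<le> mu * D (Suc i) N" using super[of "Suc i" N] base b_top by simp
    finally have "mu * c \<le> mu * D (Suc i) N" .
    then show ?case using mu_pos by simp
  next
    case (step n)
    have IH: "c \<le> D (Suc i) (n + 1)" using step by simp
    have "(b n + mu) * c \<le> b n * D (Suc i) (n + 1) + mu * after_service r g D (Suc i) n"
      using IH after[of n] step mu_pos b_nonneg[of n]
      by (simp only: distrib_right) (intro add_mono mult_left_mono; simp)
    also have "\<dots> \<le> (b n + mu) * D (Suc i) n" using super step by simp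
    finally show ?case using rate_pos[of n] by simp
  qed
qed

text \<open>
  If the smallest diagonal value \<open>M\<close> were negative, one full cycle would bound all values below by
  \<open>(1 - q) * M > M\<close>.  The coefficient \<open>k\<close> may vary with the size so that the result also covers a
  tagged customer who reneges.
\<close>

lemma homogeneous_nonneg:
  assumes super: "\<And>i j. 1 \<le> i \<Longrightarrow> i \<le> j \<Longrightarrow> j \<le> N \<Longrightarrow>
      b j * D i (j + 1) + mu * after_service r (\<lambda>j. k j * D j j) D i j \<le> (b j + mu) * D i j"
    and k: "\<And>j. 1 \<le> j \<Longrightarrow> j \<le> N \<Longrightarrow> 0 \<le> k j \<and> k j \<le> 1 - q"
    and ij: "1 \<le> i" "i \<le> j" "j \<le> N"
  shows "0 \<le> D i j"
proof -
  define M where "M = Min ((\<lambda>j. D j j) ` {1..N})"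
  have fin: "finite ((\<lambda>j. D j j) ` {1..N})" "(\<lambda>j. D j j) ` {1..N} \<noteq> {}" using ij by auto
  have M_le: "M \<le> D j j" if "1 \<le> j" "j \<le> N" for j
    unfolding M_def using that by (intro Min_le) auto
  have "M \<in> (\<lambda>j. D j j) ` {1..N}" unfolding M_def using fin by (rule Min_in)
  then obtain j0 where j0: "1 \<le> j0" "j0 \<le> N" "M = D j0 j0" by auto
  have key: "(1 - q) * min M 0 \<le> k j * D j j" if "1 \<le> j" "j \<le> N" for j
  proof -
    have "(1 - q) * min M 0 \<le> k j * min M 0"
      using k[OF that] by (intro mult_right_mono_neg) auto
    also have "\<dots> \<le> k j * D j j" using k[OF that] M_le[OF that] by (intro mult_left_mono) auto
    finally show ?thesis .
  qed
  have bound: "(1 - q) * min M 0 \<le> D i j" if "1 \<le> i" "i \<le> j" "j \<le> N" for i j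
    using lower_bound[OF super key that] .
  have "0 \<le> M"
  proof (rule ccontr)
    assume "\<not> 0 \<le> M"
    then have "(1 - q) * M \<le> M" "M < 0" using bound[of j0 j0] j0 by (auto simp: min_def split: if_splits)
    then have "0 \<le> q * M" by (simp add: algebra_simps)
    then show False using q_pos \<open>M < 0\<close> by (simp add: zero_le_mult_iff)
  qed
  then show ?thesis using bound[OF ij] by (simp add: min_absorb2)
qed

lemma homogeneous_zero:
  assumes hom: "\<And>i j. 1 \<le> i \<Longrightarrow> i \<le> j \<Longrightarrow> j \<le> N \<Longrightarrow>
      (b j + mu) * D i j = b j * D i (j + 1) + mu * after_service r (\<lambda>j. k j * D j j) D i j"
    and k: "\<And>j. 1 \<le> j \<Longrightarrow> j \<le> N \<Longrightarrow> 0 \<le> k j \<and> k j \<le> 1 - q"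
    and ij: "1 \<le> i" "i \<le> j" "j \<le> N"
  shows "D i j = 0"
proof -
  have "0 \<le> D i j"
    by (rule homogeneous_nonneg[where k = k]) (use hom k ij in auto)
  moreover have "0 \<le> (\<lambda>i j. - D i j) i j"
  proof (rule homogeneous_nonneg[where k = k])
    show "b j * - D i (j + 1) + mu * after_service r (\<lambda>j. k j * - D j j) (\<lambda>i j. - D i j) i j
        \<le> (b j + mu) * - D i j" if "1 \<le> i" "i \<le> j" "j \<le> N" for i j
      using hom[OF that] by (simp add: after_service_def algebra_simps split: if_splits)
  qed (use k ij in auto)
  ultimately show ?thesis by simp
qed

lemma sojourn_unique:
  assumes "sojourn N b r mu q v" "sojourn N b r mu q w" "1 \<le> i" "i \<le> j" "j \<le> N"
  shows "v i j = w i j"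
proof -
  have "(\<lambda>i j. v i j - w i j) i j = 0"
  proof (rule homogeneous_zero[where k = "\<lambda>_. 1 - q"])
    show "(b j + mu) * (v i j - w i j) = b j * (v i (j + 1) - w i (j + 1)) +
        mu * after_service r (\<lambda>j. (1 - q) * (v j j - w j j)) (\<lambda>i j. v i j - w i j) i j"
      if "1 \<le> i" "i \<le> j" "j \<le> N" for i j
      using cycle_systemD[OF assms(1) that] cycle_systemD[OF assms(2) that]
      by (simp add: after_service_def algebra_simps split: if_splits)
  qed (use assms q_less in auto)
  then show ?thesis by simp
qed

text \<open>
  The expected time until the tagged customer succeeds or receives her \<open>n\<close>-th service, whichever
  comes first.  This is value iteration in which one step is a whole cycle rather than one event.
  Event-wise iteration would not preserve monotonicity: comparing \<open>w 1 j\<close> with \<open>w 2 (j + 1)\<close> after one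
  event leads to \<open>w j j\<close> against \<open>w 1 (j + 1)\<close>, which can be ordered the other way.
\<close>

function truncated_time :: "nat \<Rightarrow> nat \<Rightarrow> nat \<Rightarrow> real" where
  "truncated_time n i j =
     (if n = 0 \<or> i = 0 \<or> N < j then 0
      else (1 + b j * truncated_time n i (j + 1) +
        mu * (if i = 1 then (1 - q) * truncated_time (n - 1) j j
          else r j * truncated_time n (i - 1) (j - 1) + (1 - r j) * truncated_time n (i - 1) j))
        / (b j + mu))"
  by pat_completeness auto
termination
  by (relation "measures [\<lambda>(n, i, j). n, \<lambda>(n, i, j). i, \<lambda>(n, i, j). Suc N - j]") auto

declare truncated_time.simps [simp del]

lemma truncated_time_0 [simp]: "truncated_time 0 i j = 0"
  by (simp add: truncated_time.simps)

lemma truncated_time_Suc: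
  "cycle_system N b r mu (\<lambda>j. (1 - q) * truncated_time n j j) (truncated_time (Suc n))"
  unfolding cycle_system_def
proof clarify
  fix i j assume "(i, j) \<in> states N"
  then show "(b j + mu) * truncated_time (Suc n) i j = 1 + b j * truncated_time (Suc n) i (j + 1) +
     mu * after_service r (\<lambda>j. (1 - q) * truncated_time n j j) (truncated_time (Suc n)) i j"
    using rate_pos[of j] by (subst truncated_time.simps) (auto simp: after_service_def)
qed

lemma truncated_time_mono:
  "1 \<le> i \<Longrightarrow> i \<le> j \<Longrightarrow> j \<le> N \<Longrightarrow> truncated_time n i j \<le> truncated_time (Suc n) i j"
proof (induction n arbitrary: i j)
  case 0
  have "0 \<le> truncated_time (Suc 0) i j"
    by (rule lower_bound[where g = "\<lambda>_. 0"])
      (use 0 cycle_systemD[OF truncated_time_Suc[of 0]] in auto)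
  then show ?case by simp
next
  case (Suc n)
  let ?D = "\<lambda>i j. truncated_time (Suc (Suc n)) i j - truncated_time (Suc n) i j"
  have "0 \<le> ?D i j"
  proof (rule lower_bound)
    show "b j * ?D i (j + 1) +
        mu * after_service r (\<lambda>j. (1 - q) * (truncated_time (Suc n) j j - truncated_time n j j)) ?D i j
        \<le> (b j + mu) * ?D i j" if "1 \<le> i" "i \<le> j" "j \<le> N" for i j
      using cycle_systemD[OF truncated_time_Suc[of "Suc n"] that]
        cycle_systemD[OF truncated_time_Suc[of n] that]
      by (simp add: after_service_def algebra_simps split: if_splits)
    show "0 \<le> (1 - q) * (truncated_time (Suc n) j j - truncated_time n j j)"
      if "1 \<le> j" "j \<le> N" for j
      using Suc.IH[of j j] that q_less by simp
  qed (use Suc.prems in auto)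
  then show ?case by simp
qed

text \<open>
  The bound is a supersolution: the summand \<open>i / mu\<close> pays for the services up to the own one, and
  \<open>N / (q * mu)\<close> for at most \<open>N\<close> services in each of the \<open>1 / q\<close> expected cycles.
\<close>

lemma truncated_time_bounded:
  "1 \<le> i \<Longrightarrow> i \<le> j \<Longrightarrow> j \<le> N \<Longrightarrow> truncated_time n i j \<le> real N / (q * mu) + real i / mu"
proof (induction n arbitrary: i j)
  case 0
  then show ?case using q_pos mu_pos by simp
next
  case (Suc n)
  define K where "K = real N / (q * mu)"
  let ?D = "\<lambda>i j. K + real i / mu - truncated_time (Suc n) i j"
  have K: "q * K = real N / mu" using q_pos by (simp add: K_def)
  have "0 \<le> ?D i j"
  proof (rule lower_bound)
    show "b j * ?D i (j + 1) + mu * after_service r (\<lambda>j. K - (1 - q) * truncated_time n j j) ?D i j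
        \<le> (b j + mu) * ?D i j" if "1 \<le> i" "i \<le> j" "j \<le> N" for i j
    proof (cases "i = 1")
      case True
      then show ?thesis using cycle_systemD[OF truncated_time_Suc[of n] that] mu_pos
        by (simp add: after_service_def algebra_simps)
    next
      case False
      define t where "t = 1 / mu"
      define a where "a = real (i - 1) / mu"
      have "real i = real (i - 1) + 1" using that by simp
      then have "real i / mu = (real (i - 1) + 1) / mu" by (rule arg_cong)
      then have a: "real i / mu = a + t" unfolding a_def t_def add_divide_distrib .
      have t: "mu * t = 1" using mu_pos by (simp add: t_def)
      show ?thesis using cycle_systemD[OF truncated_time_Suc[of n] that] False
        unfolding after_service_def a a_def[symmetric] by (simp add: algebra_simps t)
    qed
    show "0 \<le> K - (1 - q) * truncated_time n j j" if "1 \<le> j" "j \<le> N" for j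
    proof -
      have "truncated_time n j j \<le> K + real j / mu" using Suc.IH[of j j] that K_def by simp
      also have "\<dots> \<le> K + q * K" using that mu_pos by (simp add: K divide_right_mono)
      finally have "(1 - q) * truncated_time n j j \<le> (1 - q) * (K + q * K)"
        using q_less by (intro mult_left_mono) auto
      also have "\<dots> = K - q * q * K" by (simp add: algebra_simps)
      also have "\<dots> \<le> K" using q_pos mu_pos by (simp add: K_def)
      finally show ?thesis by simp
    qed
  qed (use Suc.prems in auto)
  then show ?case by (simp add: K_def)
qed

definition expected_time :: "nat \<Rightarrow> nat \<Rightarrow> real" where
  "expected_time i j =
     (if (i, j) \<in> states N then lim (\<lambda>n. truncated_time n i j) else 0)"

lemma truncated_time_tendsto:
  assumes "1 \<le> i" "i \<le> j" "j \<le> N"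
  shows "(\<lambda>n. truncated_time n i j) \<longlonglongrightarrow> expected_time i j"
proof -
  have "incseq (\<lambda>n. truncated_time n i j)"
    using truncated_time_mono assms by (intro incseq_SucI) auto
  then obtain L where "(\<lambda>n. truncated_time n i j) \<longlonglongrightarrow> L"
    using incseq_convergent truncated_time_bounded assms by metis
  then show ?thesis using assms by (simp add: expected_time_def limI)
qed

lemma expected_time_sojourn: "sojourn N b r mu q expected_time"
  unfolding cycle_system_def
proof clarify
  fix i j assume "(i, j) \<in> states N"
  then have ij: "1 \<le> i" "i \<le> j" "j \<le> N" by auto
  note lims = truncated_time_tendsto LIMSEQ_Suc[OF truncated_time_tendsto]
  have up: "(\<lambda>n. b j * truncated_time (Suc n) i (j + 1)) \<longlonglongrightarrow> b j * expected_time i (j + 1)"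
  proof (cases "j = N")
    case True
    then show ?thesis by (simp add: b_top)
  next
    case False
    then show ?thesis using ij by (intro tendsto_mult_left lims) auto
  qed
  have after: "(\<lambda>n. after_service r (\<lambda>j. (1 - q) * truncated_time n j j) (truncated_time (Suc n)) i j)
      \<longlonglongrightarrow> after_service r (\<lambda>j. (1 - q) * expected_time j j) expected_time i j"
    unfolding after_service_def using ij
    by (cases "i = 1"; simp) (intro tendsto_intros lims; simp)+
  have "(\<lambda>n. (b j + mu) * truncated_time (Suc n) i j) \<longlonglongrightarrow> (b j + mu) * expected_time i j"
    using ij by (intro tendsto_mult_left lims)
  moreover have "(\<lambda>n. (b j + mu) * truncated_time (Suc n) i j) \<longlonglongrightarrow> 1 + b j * expected_time i (j + 1)
      + mu * after_service r (\<lambda>j. (1 - q) * expected_time j j) expected_time i j"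
    unfolding cycle_systemD[OF truncated_time_Suc ij]
    by (intro tendsto_intros up after)
  ultimately show "(b j + mu) * expected_time i j = 1 + b j * expected_time i (j + 1)
      + mu * after_service r (\<lambda>j. (1 - q) * expected_time j j) expected_time i j"
    by (rule LIMSEQ_unique)
qed

lemma the_sojourn:
  "sojourn N b r mu q w \<and> (\<forall>i j. (i, j) \<notin> states N \<longrightarrow> w i j = 0) \<longleftrightarrow> w = expected_time"
proof
  assume w: "sojourn N b r mu q w \<and> (\<forall>i j. (i, j) \<notin> states N \<longrightarrow> w i j = 0)"
  show "w = expected_time"
  proof (intro ext)
    fix i j
    show "w i j = expected_time i j"
    proof (cases "(i, j) \<in> states N")
      case True
      then show ?thesis using sojourn_unique[OF conjunct1[OF w] expected_time_sojourn] by simp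
    next
      case False
      then show ?thesis using w by (auto simp: expected_time_def)
    qed
  qed
next
  assume "w = expected_time"
  then show "sojourn N b r mu q w \<and> (\<forall>i j. (i, j) \<notin> states N \<longrightarrow> w i j = 0)"
    using expected_time_sojourn by (simp add: expected_time_def)
qed

section \<open>Congestion delays the tagged customer\<close>

text \<open>
  Increments in the size satisfy a system of the same kind: increments at position
  \<open>i - 1\<close>, and at position \<open>i\<close> with a larger size, enter with nonnegative coefficients only.
\<close>

lemma size_increment_eq:
  assumes w: "cycle_system N b r mu g w" and ij: "1 \<le> i" "i \<le> j" "j < N"
  shows "(b j + mu) * (w i (j + 1) - w i j) = b (j + 1) * (w i (j + 2) - w i (j + 1)) +
    mu * (if i = 1 then g (j + 1) - g j
      else r j * (w (i - 1) j - w (i - 1) (j - 1))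
        + (1 - r (j + 1)) * (w (i - 1) (j + 1) - w (i - 1) j))"
proof -
  have j2: "j + 1 + 1 = j + 2" by simp
  show ?thesis
    using cycle_systemD[OF w, of i j] cycle_systemD[OF w, of i "j + 1"] ij
    unfolding j2 by (simp add: after_service_def algebra_simps split: if_splits)
qed

lemma mono_in_size:
  assumes w: "cycle_system N b r mu g w"
    and g: "\<And>j. 1 \<le> j \<Longrightarrow> j < N \<Longrightarrow> g j \<le> g (j + 1)"
    and "1 \<le> i" "i \<le> j" "j < N"
  shows "w i j \<le> w i (j + 1)"
  using assms(3-)
proof (induction i arbitrary: j)
  case 0
  then show ?case by simp
next
  case (Suc i)
  let ?S = "\<lambda>j. if Suc i = 1 then g (j + 1) - g j
      else r j * (w (Suc i - 1) j - w (Suc i - 1) (j - 1))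
        + (1 - r (j + 1)) * (w (Suc i - 1) (j + 1) - w (Suc i - 1) j)"
  have S: "0 \<le> ?S j'" if j': "Suc i \<le> j'" "j' < N" for j'
  proof (cases "i = 0")
    case True
    then show ?thesis using g j' by simp
  next
    case False
    have "w i (j' - 1) \<le> w i j'" "w i j' \<le> w i (j' + 1)"
      using Suc.IH[of "j' - 1"] Suc.IH[of j'] j' False by auto
    then show ?thesis using r_pos[of j'] r_le[of "j' + 1"] False by simp
  qed
  have step: "(b j' + mu) * (w (Suc i) (j' + 1) - w (Suc i) j')
      = b (j' + 1) * (w (Suc i) (j' + 2) - w (Suc i) (j' + 1)) + mu * ?S j'"
    if "Suc i \<le> j'" "j' < N" for j'
    by (rule size_increment_eq[OF w]) (use that in auto)
  have pos: "w (Suc i) j' \<le> w (Suc i) (j' + 1)"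
    if "0 \<le> b (j' + 1) * (w (Suc i) (j' + 2) - w (Suc i) (j' + 1))" "Suc i \<le> j'" "j' < N" for j'
  proof -
    have "0 \<le> (b j' + mu) * (w (Suc i) (j' + 1) - w (Suc i) j')"
      unfolding step[OF that(2,3)] using that(1) mult_nonneg_nonneg[OF less_imp_le[OF mu_pos] S[OF that(2,3)]]
      by linarith
    then show ?thesis using rate_pos[of j'] by (simp add: zero_le_mult_iff)
  qed
  have "j \<le> N - 1" using Suc.prems by simp
  then show ?case using \<open>Suc i \<le> j\<close>
  proof (induction rule: inc_induct)
    case base
    then show ?case using pos[of "N - 1"] Suc.prems b_top by simp
  next
    case (step n)
    then show ?case using pos[of n] b_nonneg[of "n + 1"] by simp
  qed
qed

text \<open>
  A customer in position \<open>j + 1\<close> of \<open>j + 1\<close> waits for one service, of mean length \<open>1 / mu\<close>, and is then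
  in position \<open>j\<close> of at least \<open>j\<close>.  So the diagonal comparison needs only monotonicity in the size
  at a fixed position.
\<close>

lemma diagonal_gap:
  assumes w: "cycle_system N b r mu g w"
    and g: "\<And>j. 1 \<le> j \<Longrightarrow> j < N \<Longrightarrow> g j \<le> g (j + 1)"
    and j: "1 \<le> j" "j < N"
  shows "w j j + 1 / mu \<le> w (j + 1) (j + 1)"
proof -
  have "0 \<le> b (j + 1) * (w (j + 1) (j + 2) - w (j + 1) (j + 1))"
  proof (cases "j + 1 = N")
    case True
    then have "b (j + 1) = 0" using b_top by simp
    then show ?thesis by simp
  next
    case False
    then show ?thesis
      using mono_in_size[OF w g, of "j + 1" "j + 1"] j b_nonneg[of "j + 1"] by simp
  qed
  moreover have "(1 - r (j + 1)) * w j j \<le> (1 - r (j + 1)) * w j (j + 1)"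
    using mono_in_size[OF w g, of j j] j r_le[of "j + 1"] by (intro mult_left_mono) auto
  then have "w j j \<le> after_service r g w (j + 1) (j + 1)"
    using j by (simp add: after_service_def algebra_simps)
  then have "mu * w j j \<le> mu * after_service r g w (j + 1) (j + 1)" using mu_pos by simp
  ultimately have "1 + mu * w j j \<le> mu * w (j + 1) (j + 1)"
    using cycle_systemD[OF w, of "j + 1" "j + 1"] j by (simp add: algebra_simps)
  then show ?thesis using mu_pos by (simp add: field_simps)
qed

text \<open>
  The two conjuncts feed each other: a monotone diagonal gives a monotone \<open>g\<close> for the next cycle,
  and monotonicity in the size gives the next diagonal.
\<close>

lemma truncated_time_mono_in_size:
  "(\<forall>i j. 1 \<le> i \<and> i \<le> j \<and> j < N \<longrightarrow> truncated_time n i j \<le> truncated_time n i (j + 1)) \<and>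
   (\<forall>j. 1 \<le> j \<and> j < N \<longrightarrow> truncated_time n j j \<le> truncated_time n (j + 1) (j + 1))"
proof (induction n)
  case 0
  then show ?case by simp
next
  case (Suc n)
  have g: "(1 - q) * truncated_time n j j \<le> (1 - q) * truncated_time n (j + 1) (j + 1)"
    if "1 \<le> j" "j < N" for j
    using Suc that q_less by (intro mult_left_mono) auto
  have "truncated_time (Suc n) j j \<le> truncated_time (Suc n) (j + 1) (j + 1)"
    if "1 \<le> j" "j < N" for j
  proof -
    have "0 < 1 / mu" using mu_pos by simp
    then show ?thesis using diagonal_gap[OF truncated_time_Suc g that] by linarith
  qed
  then show ?case using mono_in_size[OF truncated_time_Suc g] by blast
qed

lemma sojourn_diagonal_gap:
  assumes w: "sojourn N b r mu q w" and j: "1 \<le> j" "j < N"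
  shows "w j j + 1 / mu \<le> w (j + 1) (j + 1)"
proof (rule diagonal_gap[OF w _ j])
  fix j assume j: "1 \<le> j" "j < N"
  have "expected_time j j \<le> expected_time (j + 1) (j + 1)"
    by (rule LIMSEQ_le[OF truncated_time_tendsto truncated_time_tendsto])
      (use j truncated_time_mono_in_size in auto)
  then have "w j j \<le> w (j + 1) (j + 1)"
    using sojourn_unique[OF w expected_time_sojourn] j by simp
  then show "(1 - q) * w j j \<le> (1 - q) * w (j + 1) (j + 1)"
    using q_less by (intro mult_left_mono) auto
qed

lemma sojourn_strict_mono_in_size:
  assumes w: "sojourn N b r mu q w" and "1 \<le> i" "i \<le> j" "j < N"
  shows "w i j < w i (j + 1)"
  using assms(2-)
proof (induction i arbitrary: j)
  case 0
  then show ?case by simp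
next
  case (Suc i)
  have diag: "w j j < w (j + 1) (j + 1)" if "1 \<le> j" "j < N" for j
  proof -
    have "0 < 1 / mu" using mu_pos by simp
    then show ?thesis using sojourn_diagonal_gap[OF w that] by linarith
  qed
  have weak: "w i' j' \<le> w i' (j' + 1)" if "1 \<le> i'" "i' \<le> j'" "j' < N" for i' j'
    using mono_in_size[OF w _ that] diag q_less by (simp add: less_imp_le)
  have "0 \<le> b (j + 1) * (w (Suc i) (j + 2) - w (Suc i) (j + 1))"
  proof (cases "j + 1 = N")
    case True
    then have "b (j + 1) = 0" using b_top by simp
    then show ?thesis by simp
  next
    case False
    then show ?thesis using weak[of "Suc i" "j + 1"] Suc.prems b_nonneg[of "j + 1"] by simp
  qed
  moreover have "0 < (if Suc i = 1 then (1 - q) * w (j + 1) (j + 1) - (1 - q) * w j j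
      else r j * (w (Suc i - 1) j - w (Suc i - 1) (j - 1))
        + (1 - r (j + 1)) * (w (Suc i - 1) (j + 1) - w (Suc i - 1) j))"
  proof (cases "i = 0")
    case True
    then show ?thesis using diag[of j] Suc.prems q_less by simp
  next
    case False
    have "w i (j - 1) < w i j" using Suc.IH[of "j - 1"] Suc.prems False by simp
    moreover have "w i j \<le> w i (j + 1)" using weak[of i j] Suc.prems False by simp
    ultimately show ?thesis using r_pos[of j] r_le[of "j + 1"] False
      by (simp add: add_pos_nonneg)
  qed
  ultimately have "0 < (b j + mu) * (w (Suc i) (j + 1) - w (Suc i) j)"
    unfolding size_increment_eq[OF w Suc.prems] using mu_pos by (intro add_nonneg_pos mult_pos_pos)
  then show ?case using rate_pos[of j] by (simp add: zero_less_mult_iff)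
qed

end

text \<open>
  On sizes up to \<open>N\<close> the difference \<open>v - w\<close> solves the homogeneous system of the smaller queue with
  the additional source \<open>c N * (v i (N + 1) - v i N)\<close> at size \<open>N\<close>, which is positive because congestion
  delays.  From size \<open>N\<close> the strictness spreads to smaller sizes through the positive arrival rates.
\<close>

lemma blocking_shortens_sojourn:
  assumes w: "tagged_queue N b r mu q" "sojourn N b r mu q w"
    and v: "tagged_queue M c s mu q" "sojourn M c s mu q v"
    and "N < M"
    and below: "\<And>j. 1 \<le> j \<Longrightarrow> j < N \<Longrightarrow> 0 < b j \<and> c j = b j"
    and top: "0 < c N"
    and rs: "\<And>j. 1 \<le> j \<Longrightarrow> j \<le> N \<Longrightarrow> s j = r j"
    and ij: "1 \<le> i" "i \<le> j" "j \<le> N"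
  shows "w i j < v i j"
proof -
  interpret W: tagged_queue N b r mu q by fact
  interpret V: tagged_queue M c s mu q by fact
  let ?D = "\<lambda>i j. v i j - w i j"
  have eq: "(b j + mu) * ?D i j = b j * ?D i (j + 1)
      + (if j = N then c N * (v i (N + 1) - v i N) else 0)
      + mu * after_service r (\<lambda>j. (1 - q) * ?D j j) ?D i j"
    if "1 \<le> i" "i \<le> j" "j \<le> N" for i j
  proof -
    have s: "s j = r j" using rs that by simp
    have bc: "j \<noteq> N \<Longrightarrow> c j = b j" using below[of j] that by simp
    show ?thesis
      using cycle_systemD[OF w(2) that] cycle_systemD[OF v(2), of i j] that \<open>N < M\<close> W.b_top
      by (auto simp: s bc after_service_def algebra_simps split: if_splits)
  qed
  have ex: "0 < c N * (v i (N + 1) - v i N)" if "1 \<le> i" "i \<le> N" for i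
    using V.sojourn_strict_mono_in_size[OF v(2), of i N] that top \<open>N < M\<close> by simp
  have nonneg: "0 \<le> ?D i j" if "1 \<le> i" "i \<le> j" "j \<le> N" for i j
  proof (rule W.homogeneous_nonneg[where k = "\<lambda>_. 1 - q"])
    show "b j * ?D i (j + 1) + mu * after_service r (\<lambda>j. (1 - q) * ?D j j) ?D i j
        \<le> (b j + mu) * ?D i j" if "1 \<le> i" "i \<le> j" "j \<le> N" for i j
      using eq[OF that] ex[of i] that by simp
  qed (use W.q_less that in auto)
  have after: "0 \<le> mu * after_service r (\<lambda>j. (1 - q) * ?D j j) ?D i j"
    if "1 \<le> i" "i \<le> j" "j \<le> N" for i j
  proof -
    have "0 \<le> (1 - q) * ?D j j" using nonneg[of j j] that W.q_less by (intro mult_nonneg_nonneg) auto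
    moreover have "0 \<le> r j * ?D (i - 1) (j - 1) + (1 - r j) * ?D (i - 1) j" if "i \<noteq> 1"
    proof -
      have "0 \<le> ?D (i - 1) (j - 1)" "0 \<le> ?D (i - 1) j"
        using nonneg[of "i - 1" "j - 1"] nonneg[of "i - 1" j]
          that \<open>1 \<le> i\<close> \<open>i \<le> j\<close> \<open>j \<le> N\<close> by auto
      then show ?thesis using W.r_pos[of j] W.r_le[of j]
        by (intro add_nonneg_nonneg mult_nonneg_nonneg) auto
    qed
    ultimately show ?thesis using W.mu_pos by (simp add: after_service_def)
  qed
  from ij(3,1,2) have "0 < ?D i j"
  proof (induction rule: inc_induct)
    case base
    have "0 < mu * ?D i N"
      using eq[of i N] ex[of i] after[of i N] base by (simp add: W.b_top)
    then show ?case using W.mu_pos by (simp add: zero_less_mult_iff)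
  next
    case (step n)
    have "0 < b n * ?D i (n + 1)" using step below[of n] by simp
    then have "0 < (b n + mu) * ?D i n"
      using eq[of i n] after[of i n] step by simp
    then show ?case using W.rate_pos[of n] by (simp add: zero_less_mult_iff)
  qed
  then show ?thesis by simp
qed

section \<open>Birth-death chains with finite support\<close>

definition bd_weight :: "(nat \<Rightarrow> real) \<Rightarrow> (nat \<Rightarrow> real) \<Rightarrow> nat \<Rightarrow> real" where
  "bd_weight b d j = (\<Prod>i<j. b i / d (i + 1))"

lemma stationary_bd_eq:
  fixes b d :: "nat \<Rightarrow> real"
  assumes b: "\<And>j. 0 \<le> b j" "\<And>j. M \<le> j \<Longrightarrow> b j = 0" and d: "\<And>j. 1 \<le> j \<Longrightarrow> 0 < d j"
  shows "(THE p. stationary_bd b d p) = (\<lambda>j. bd_weight b d j / (\<Sum>k\<le>M. bd_weight b d k))"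
proof -
  let ?h = "bd_weight b d"
  define S where "S = (\<Sum>k\<le>M. ?h k)"
  have h_nonneg: "0 \<le> ?h j" for j
    unfolding bd_weight_def by (intro prod_nonneg ballI divide_nonneg_pos b d) auto
  have h_Suc: "?h (j + 1) * d (j + 1) = b j * ?h j" for j
    using d[of "j + 1"] by (simp add: bd_weight_def)
  have h_0: "?h 0 = 1" by (simp add: bd_weight_def)
  have h_zero: "?h j = 0" if "M < j" for j
    unfolding bd_weight_def using that b(2)[of M] by (intro prod_zero) auto
  have "?h 0 \<le> S" unfolding S_def by (intro member_le_sum h_nonneg) auto
  then have S: "0 < S" using h_0 by simp
  have h_sums: "?h sums S"
    unfolding S_def using h_zero by (intro sums_finite) (auto simp: not_le)
  show ?thesis unfolding S_def[symmetric]
  proof (rule the_equality)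
    show "stationary_bd b d (\<lambda>j. ?h j / S)"
      unfolding stationary_bd_def
    proof (intro conjI allI impI)
      show "0 \<le> ?h j / S" for j using h_nonneg S by simp
      show "(\<lambda>j. ?h j / S) sums 1" using sums_divide[OF h_sums, of S] S by simp
      show "b 0 * (?h 0 / S) = d 1 * (?h 1 / S)" using h_Suc[of 0] by (simp add: mult.commute)
      show "(b j + d j) * (?h j / S) = b (j - 1) * (?h (j - 1) / S) + d (j + 1) * (?h (j + 1) / S)"
        if "1 \<le> j" for j
        using h_Suc[of j] h_Suc[of "j - 1"] that S by (simp add: field_simps)
    qed
  next
    fix p assume "stationary_bd b d p"
    then have p: "p sums 1" "b 0 * p 0 = d 1 * p 1"
      "\<And>j. 1 \<le> j \<Longrightarrow> (b j + d j) * p j = b (j - 1) * p (j - 1) + d (j + 1) * p (j + 1)"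
      by (auto simp: stationary_bd_def)
    \<comment> \<open>Detailed balance: global balance is a telescoping sum of the cut equations.\<close>
    have flow: "b j * p j = d (j + 1) * p (j + 1)" for j
    proof (induction j)
      case 0
      then show ?case using p(2) by simp
    next
      case (Suc j)
      then show ?case using p(3)[of "Suc j"] by (simp add: algebra_simps)
    qed
    have p_eq: "p j = p 0 * ?h j" for j
    proof (induction j)
      case 0
      then show ?case by (simp add: h_0)
    next
      case (Suc j)
      have "d (j + 1) * p (j + 1) = d (j + 1) * (p 0 * ?h (j + 1))"
        using flow[of j] h_Suc[of j] by (simp add: Suc mult_ac)
      then show ?case using d[of "j + 1"] by simp
    qed
    have "p = (\<lambda>j. p 0 * ?h j)" by (rule ext) (rule p_eq)
    then have "p sums (p 0 * S)" using sums_mult[OF h_sums, of "p 0"] by simp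
    then have "p 0 * S = 1" using p(1) sums_unique2 by blast
    then have p0: "p 0 = 1 / S" using S by (simp add: field_simps)
    show "p = (\<lambda>j. ?h j / S)"
    proof (rule ext)
      show "p j = ?h j / S" for j using p_eq[of j] unfolding p0 by simp
    qed
  qed
qed

section \<open>The two queues as instances\<close>

lemma join_prob_between:
  assumes "real k \<le> x" "x < real (k + 1)"
  shows "join_prob x j = (if j \<le> k then 1 else if j = k + 1 then x - real k else 0)"
proof -
  have "\<lfloor>x\<rfloor> = int k" using assms by (intro floor_unique) auto
  then show ?thesis by (auto simp: join_prob_def)
qed

lemma join_prob_nat [simp]: "join_prob (real k) j = (if j \<le> k then 1 else 0)"
  by (simp add: join_prob_between[of k])

lemma join_prob_Suc_nat [simp]: "join_prob (1 + real k) j = (if j \<le> k + 1 then 1 else 0)"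
  using join_prob_nat[of "Suc k" j] by simp

lemma join_prob_bounds: "0 \<le> join_prob x j" "join_prob x j \<le> 1"
  by (auto simp: join_prob_def) linarith

locale service_parameters =
  fixes lam mu q :: real
  assumes lam_pos: "0 < lam" and mu_pos: "0 < mu" and q_pos: "0 < q" and q_less: "q < 1"
begin

lemma N_queue: "tagged_queue (k + 1) (\<lambda>j. lam * join_prob (real k) (j + 1)) (\<lambda>_. q) mu q"
  using lam_pos mu_pos q_pos q_less by unfold_locales auto

lemma N_time_sojourn:
  "sojourn (k + 1) (\<lambda>j. lam * join_prob (real k) (j + 1)) (\<lambda>_. q) mu q (N_time lam mu q (real k))"
proof -
  let ?b = "\<lambda>j. lam * join_prob (real k) (j + 1)"
  interpret tagged_queue "k + 1" ?b "\<lambda>_. q" mu q by (rule N_queue)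
  have "N_system lam mu q (real k) w \<longleftrightarrow> w = expected_time" for w
  proof -
    have "N_system lam mu q (real k) w \<longleftrightarrow>
        sojourn (k + 1) ?b (\<lambda>_. q) mu q w \<and> (\<forall>i j. (i, j) \<notin> states (k + 1) \<longrightarrow> w i j = 0)"
      unfolding N_system_def cycle_system_def after_service_def N_succ_def
      by (intro arg_cong2[where f = "(\<and>)"] ball_cong) (auto simp: algebra_simps)
    then show ?thesis using the_sojourn by simp
  qed
  then have "N_time lam mu q (real k) = expected_time" by (simp add: N_time_def)
  then show ?thesis using expected_time_sojourn by simp
qed

abbreviation R_departure :: "real \<Rightarrow> nat \<Rightarrow> real" where
  "R_departure x j \<equiv> q + (1 - q) * (1 - join_prob x j)"

lemma R_queue:
  assumes "real k \<le> x" "x < real (k + 1)"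
  shows "tagged_queue (k + 1) (\<lambda>j. lam * join_prob x (j + 1)) (R_departure x) mu q"
proof
  fix j
  show "0 \<le> lam * join_prob x (j + 1)" using lam_pos join_prob_bounds by simp
  show "lam * join_prob x (k + 1 + 1) = 0" using join_prob_between[OF assms] by simp
  have "0 \<le> (1 - q) * (1 - join_prob x j)" "(1 - q) * (1 - join_prob x j) \<le> (1 - q) * 1"
    using q_less join_prob_bounds[of x j] by (auto intro!: mult_nonneg_nonneg mult_left_mono simp del: mult_1_right)
  then show "0 < R_departure x j" "R_departure x j \<le> 1" using q_pos by simp_all
qed (use mu_pos q_pos q_less in auto)

text \<open>
  Uniqueness is needed for an arbitrary tagged threshold \<open>y\<close>, since the payoff at \<open>y = x\<close> is
  identified with the one at \<open>y = k + 1\<close>.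
\<close>

lemma R_system_unique:
  assumes x: "real k \<le> x" "x < real (k + 1)"
    and z: "R_system lam mu q R0 y x z" "R_system lam mu q R0 y x z'"
  shows "z = z'"
proof (intro ext)
  fix i j
  let ?b = "\<lambda>j. lam * join_prob x (j + 1)"
  interpret tagged_queue "k + 1" ?b "R_departure x" mu q by (rule R_queue[OF x])
  have fl: "\<lfloor>x\<rfloor> = int k" using x by (intro floor_unique) auto
  show "z i j = z' i j"
  proof (cases "(i, j) \<in> states (k + 1)")
    case True
    have "(\<lambda>i j. z i j - z' i j) i j = 0"
    proof (rule homogeneous_zero[where k = "\<lambda>j. (1 - q) * join_prob y j"])
      fix i j assume ij: "1 \<le> i" "i \<le> j" "j \<le> k + 1"
      have "(lam + mu) * z i j =
          - 1 + lam * (join_prob x (j + 1) * z i (j + 1) + (1 - join_prob x (j + 1)) * z i j)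
            + mu * R_succ q R0 y x z i j"
        "(lam + mu) * z' i j =
          - 1 + lam * (join_prob x (j + 1) * z' i (j + 1) + (1 - join_prob x (j + 1)) * z' i j)
            + mu * R_succ q R0 y x z' i j"
        using z ij by (auto simp: R_system_def fl)
      then show "(?b j + mu) * (z i j - z' i j) = ?b j * (z i (j + 1) - z' i (j + 1)) + mu *
          after_service (R_departure x) (\<lambda>j. (1 - q) * join_prob y j * (z j j - z' j j))
            (\<lambda>i j. z i j - z' i j) i j"
        by (simp add: after_service_def R_succ_def algebra_simps split: if_splits)
    next
      show "0 \<le> (1 - q) * join_prob y j \<and> (1 - q) * join_prob y j \<le> 1 - q" for j
        using q_less join_prob_bounds[of y j] mult_left_mono[of "join_prob y j" 1 "1 - q"] by simp
    qed (use True in auto)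
    then show ?thesis by simp
  next
    case False
    have "z i j = 0" "z' i j = 0" using z False unfolding R_system_def fl by auto
    then show ?thesis by simp
  qed
qed

lemma R_payoff_eq:
  assumes "real k \<le> x" "x < real (k + 1)" "R_system lam mu q R0 y x z"
  shows "R_payoff lam mu q R0 y x = z"
  unfolding R_payoff_def using assms R_system_unique by blast

lemma R_payoff_never_renege:
  assumes x: "real k \<le> x" "x < real (k + 1)"
  shows "R_system lam mu q R0 (real (k + 1)) x (R_payoff lam mu q R0 (real (k + 1)) x)"
    and "sojourn (k + 1) (\<lambda>j. lam * join_prob x (j + 1)) (R_departure x) mu q
      (\<lambda>i j. R0 - R_payoff lam mu q R0 (real (k + 1)) x i j)"
proof -
  let ?b = "\<lambda>j. lam * join_prob x (j + 1)"
  interpret tagged_queue "k + 1" ?b "R_departure x" mu q by (rule R_queue[OF x])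
  have fl: "\<lfloor>x\<rfloor> = int k" using x by (intro floor_unique) auto
  have top: "join_prob x (k + 2) = 0" using join_prob_between[OF x] by simp
  have jp: "join_prob (real (k + 1)) j = 1" if "j \<le> k + 1" for j
    using that by (simp only: join_prob_nat if_True)
  define z where "z i j = (if (i, j) \<in> states (k + 1) then R0 - expected_time i j else 0)" for i j
  have sys: "R_system lam mu q R0 (real (k + 1)) x z"
    unfolding R_system_def fl
  proof (intro conjI)
    show "\<forall>(i, j) \<in> states (nat (int k) + 1). (lam + mu) * z i j =
          - 1 + lam * (join_prob x (j + 1) * z i (j + 1) + (1 - join_prob x (j + 1)) * z i j)
            + mu * R_succ q R0 (real (k + 1)) x z i j"
    proof clarify
      fix i j assume "(i, j) \<in> states (nat (int k) + 1)"
      then have ij: "1 \<le> i" "i \<le> j" "j \<le> k + 1" by auto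
      have up: "join_prob x (j + 1) * z i (j + 1)
          = join_prob x (j + 1) * (R0 - expected_time i (j + 1))"
        using ij top by (cases "j = k + 1") (auto simp: z_def)
      have succ: "R_succ q R0 (real (k + 1)) x z i j = R0 - after_service (R_departure x)
          (\<lambda>j. (1 - q) * expected_time j j) expected_time i j"
        using ij jp[of j] by (cases "i = 1") (auto simp: R_succ_def after_service_def z_def algebra_simps)
      have zij: "z i j = R0 - expected_time i j" using ij by (simp add: z_def)
      show "(lam + mu) * z i j =
          - 1 + lam * (join_prob x (j + 1) * z i (j + 1) + (1 - join_prob x (j + 1)) * z i j)
            + mu * R_succ q R0 (real (k + 1)) x z i j"
        unfolding up succ zij using cycle_systemD[OF expected_time_sojourn ij]
        by (simp add: algebra_simps)
    qed
    show "\<forall>i j. (i, j) \<notin> states (nat (int k) + 1) \<longrightarrow> z i j = 0" by (simp add: z_def)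
  qed
  have eq: "R_payoff lam mu q R0 (real (k + 1)) x = z" by (rule R_payoff_eq[OF x sys])
  show "R_system lam mu q R0 (real (k + 1)) x (R_payoff lam mu q R0 (real (k + 1)) x)"
    unfolding eq by (rule sys)
  show "sojourn (k + 1) ?b (R_departure x) mu q
      (\<lambda>i j. R0 - R_payoff lam mu q R0 (real (k + 1)) x i j)"
    unfolding cycle_system_def eq
  proof clarify
    fix i j assume "(i, j) \<in> states (k + 1)"
    then have ij: "1 \<le> i" "i \<le> j" "j \<le> k + 1" by auto
    have up: "?b j * (R0 - z i (j + 1)) = ?b j * expected_time i (j + 1)"
      using ij top by (cases "j = k + 1") (auto simp: z_def)
    have after: "after_service (R_departure x) (\<lambda>j. (1 - q) * (R0 - z j j)) (\<lambda>i j. R0 - z i j) i j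
        = after_service (R_departure x) (\<lambda>j. (1 - q) * expected_time j j) expected_time i j"
      using ij by (auto simp: after_service_def z_def)
    have zij: "R0 - z i j = expected_time i j" using ij by (simp add: z_def)
    show "(?b j + mu) * (R0 - z i j) = 1 + ?b j * (R0 - z i (j + 1)) + mu *
        after_service (R_departure x) (\<lambda>j. (1 - q) * (R0 - z j j)) (\<lambda>i j. R0 - z i j) i j"
      unfolding up after zij using cycle_systemD[OF expected_time_sojourn ij] .
  qed
qed

section \<open>Both equilibria belong to the same integer\<close>

text \<open>
  Sizes up to \<open>k\<close> form a closed set under threshold \<open>k\<close>; size \<open>k + 1\<close> occurs only when the tagged
  customer herself deviates and joins at position \<open>k + 1\<close>.
\<close>

lemma N_time_capped:
  shows "tagged_queue k (\<lambda>j. lam * join_prob (real k) (j + 1)) (\<lambda>_. q) mu q"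
    and "sojourn k (\<lambda>j. lam * join_prob (real k) (j + 1)) (\<lambda>_. q) mu q (N_time lam mu q (real k))"
proof -
  show "tagged_queue k (\<lambda>j. lam * join_prob (real k) (j + 1)) (\<lambda>_. q) mu q"
    using lam_pos mu_pos q_pos q_less by unfold_locales auto
  show "sojourn k (\<lambda>j. lam * join_prob (real k) (j + 1)) (\<lambda>_. q) mu q (N_time lam mu q (real k))"
    by (rule cycle_system_restrict[OF N_time_sojourn]) auto
qed

lemma alpha_le_beta:
  assumes "1 \<le> k"
  shows "alpha lam mu q k \<le> beta lam mu q k"
proof -
  interpret tagged_queue "k + 1" "\<lambda>j. lam * join_prob (real k) (j + 1)" "\<lambda>_. q" mu q
    by (rule N_queue)
  have "alpha lam mu q k + 1 / mu \<le> beta lam mu q k"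
    unfolding alpha_def beta_def using sojourn_diagonal_gap[OF N_time_sojourn, of k] assms by simp
  moreover have "0 < 1 / mu" using mu_pos by simp
  ultimately show ?thesis by linarith
qed

text \<open>
  Both sides concern a customer in position \<open>k + 1\<close> of \<open>k + 1\<close>; raising the threshold of the others
  admits arrivals at size \<open>k\<close>.  After one service she is, with probability \<open>q\<close>, in position \<open>k\<close> of \<open>k\<close>,
  where \<open>blocking_shortens_sojourn\<close> is strict; otherwise the size is still \<open>k + 1\<close> and a weak
  comparison is enough.
\<close>

lemma beta_less_alpha_Suc:
  assumes "1 \<le> k"
  shows "beta lam mu q k < alpha lam mu q (k + 1)"
proof -
  let ?w = "N_time lam mu q (real k)" and ?v = "N_time lam mu q (real (k + 1))"
  let ?c = "\<lambda>j. lam * join_prob (real (k + 1)) (j + 1)"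
  note w = N_time_sojourn[of k] and v = N_time_sojourn[of "k + 1"]
  interpret W: tagged_queue "k + 1" "\<lambda>j. lam * join_prob (real k) (j + 1)" "\<lambda>_. q" mu q
    by (rule N_queue)
  interpret V: tagged_queue "k + 1 + 1" ?c "\<lambda>_. q" mu q by (rule N_queue)
  have less: "?w i j < ?v i j" if "1 \<le> i" "i \<le> j" "j \<le> k" for i j
    by (rule blocking_shortens_sojourn[OF N_time_capped N_queue v])
      (use that lam_pos in auto)
  have "0 \<le> ?v k (k + 1) - ?w k (k + 1)"
  proof (rule W.homogeneous_nonneg[where k = "\<lambda>_. 1 - q" and D = "\<lambda>i j. ?v i j - ?w i j"])
    fix i j assume ij: "1 \<le> i" "i \<le> j" "j \<le> k + 1"
    have step: "?v i k < ?v i (k + 1)" if "j = k"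
      using V.sojourn_strict_mono_in_size[OF v, of i k] that ij by simp
    have "lam * ?v i k < lam * ?v i (k + 1)" if "j = k"
      using step[OF that] lam_pos by simp
    then show "lam * join_prob (real k) (j + 1) * (?v i (j + 1) - ?w i (j + 1)) +
        mu * after_service (\<lambda>_. q) (\<lambda>j. (1 - q) * (?v j j - ?w j j)) (\<lambda>i j. ?v i j - ?w i j) i j
        \<le> (lam * join_prob (real k) (j + 1) + mu) * (?v i j - ?w i j)"
      using cycle_systemD[OF w ij] cycle_systemD[OF v, of i j] ij
      unfolding join_prob_nat
      by (cases "j < k"; cases "j = k") (auto simp: after_service_def algebra_simps split: if_splits)
  qed (use assms q_less in auto)
  then have "(1 - q) * ?w k (k + 1) \<le> (1 - q) * ?v k (k + 1)"
    using q_less by (intro mult_left_mono) auto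
  moreover have "q * ?w k k < q * ?v k k" using less[of k k] assms q_pos by simp
  moreover have "mu * ?w (k + 1) (k + 1) = 1 + mu * (q * ?w k k + (1 - q) * ?w k (k + 1))"
    using cycle_systemD[OF w, of "k + 1" "k + 1"] assms
    by (simp add: after_service_def)
  moreover have "mu * ?v (k + 1) (k + 1) = 1 + mu * (q * ?v k k + (1 - q) * ?v k (k + 1))"
    using cycle_systemD[OF v, of "k + 1" "k + 1"] assms
    unfolding join_prob_nat by (simp add: after_service_def)
  ultimately have "mu * ?w (k + 1) (k + 1) < mu * ?v (k + 1) (k + 1)" using mu_pos by simp
  then show ?thesis using mu_pos by (simp add: alpha_def beta_def)
qed

lemma beta_less_alpha:
  assumes "1 \<le> k" "k < l"
  shows "beta lam mu q k < alpha lam mu q l"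
proof -
  from \<open>k < l\<close> have "k + 1 \<le> l" by simp
  then show ?thesis
  proof (induction rule: dec_induct)
    case base
    then show ?case using beta_less_alpha_Suc assms by simp
  next
    case (step n)
    then show ?case using alpha_le_beta[of n] beta_less_alpha_Suc[of n] by simp
  qed
qed

text \<open>
  With everybody else reneging at position \<open>k + 1\<close>, whoever is served first leaves, so
  \<open>gamma k = alpha k + 1 / mu\<close>.
\<close>

lemma alpha_less_gamma:
  assumes "1 \<le> k"
  shows "alpha lam mu q k < gamma lam mu q R0 k"
proof -
  let ?w = "\<lambda>i j. R0 - R_payoff lam mu q R0 (real (k + 1)) (real k) i j"
  have w: "sojourn (k + 1) (\<lambda>j. lam * join_prob (real k) (j + 1)) (R_departure (real k)) mu q ?w"
    by (rule R_payoff_never_renege) auto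
  interpret W: tagged_queue k "\<lambda>j. lam * join_prob (real k) (j + 1)" "\<lambda>_. q" mu q
    by (rule N_time_capped)
  have "sojourn k (\<lambda>j. lam * join_prob (real k) (j + 1)) (\<lambda>_. q) mu q ?w"
    by (rule cycle_system_restrict[OF w]) auto
  then have "?w k k = alpha lam mu q k"
    unfolding alpha_def
    using W.sojourn_unique[of ?w "N_time lam mu q (real k)" k k] N_time_capped(2) assms
    by simp
  moreover have "mu * ?w (k + 1) (k + 1) = 1 + mu * ?w k k"
    using cycle_systemD[OF w, of "k + 1" "k + 1"] assms by (simp add: after_service_def)
  ultimately have "mu * alpha lam mu q k < mu * ?w (k + 1) (k + 1)" by simp
  moreover have "gamma lam mu q R0 k = ?w (k + 1) (k + 1)"
    by (simp add: gamma_def R_time_def add.commute)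
  ultimately show ?thesis using mu_pos by simp
qed

lemma equilibrium_index_unique:
  assumes "1 \<le> k" "alpha lam mu q k \<le> R0" "R0 \<le> beta lam mu q k"
    and "1 \<le> l" "alpha lam mu q l \<le> R0" "R0 \<le> beta lam mu q l"
  shows "k = l"
  using beta_less_alpha[of k l] beta_less_alpha[of l k] assms by (cases k l rule: linorder_cases) auto

end

section \<open>Comparison of the equilibrium payoffs\<close>

theorem mainTheorem5:
  fixes lam mu q R0 xe xhat :: real and m :: nat
  assumes "0 < lam" and "0 < mu" and "0 < q" and "q < 1" and "0 < R0"
    and "1 \<le> m"
    and "R0 \<in> {gamma lam mu q R0 m <.. beta lam mu q m}"
    and "N_equilibrium lam mu q R0 xe"
    and "R_equilibrium lam mu q R0 xhat"
  shows "(\<forall>i\<in>{1..m}. R_payoff lam mu q R0 xhat xhat i i < N_payoff lam mu q R0 xe i i) \<and>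
    (\<Sum>i=1..m+1. R_stationary lam mu q xhat (i - 1) * R_payoff lam mu q R0 xhat xhat i i)
      < (\<Sum>i=1..m. N_stationary lam mu q xe (i - 1) * N_payoff lam mu q R0 xe i i)"
proof -
  interpret service_parameters lam mu q using assms by unfold_locales
  have m: "alpha lam mu q m \<le> R0" "R0 \<le> beta lam mu q m"
    using alpha_less_gamma[OF \<open>1 \<le> m\<close>, of R0] assms(7) by auto
  have xe: "xe = real m"
    using assms(8) equilibrium_index_unique[OF \<open>1 \<le> m\<close> m] unfolding N_equilibrium_def by metis
  obtain k where k: "1 \<le> k" "gamma lam mu q R0 k < R0" "R0 \<le> beta lam mu q k"
    "real k < xhat" "xhat < real (k + 1)"
    "R_payoff lam mu q R0 (real (k + 1)) xhat (k + 1) (k + 1) = 0"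
    using assms(9) unfolding R_equilibrium_def by blast
  have "k = m"
    using equilibrium_index_unique[OF k(1) _ k(3) \<open>1 \<le> m\<close> m] alpha_less_gamma[OF k(1), of R0] k(2)
    by simp
  note k = k[unfolded \<open>k = m\<close>]
  define z where "z = R_payoff lam mu q R0 (real (m + 1)) xhat"
  have x: "real m \<le> xhat" "xhat < real (m + 1)" using k by auto
  have fl: "\<lfloor>xhat\<rfloor> = int m" using x by (intro floor_unique) auto
  note jp = join_prob_between[OF x]
  have z_top: "z (m + 1) (m + 1) = 0" using k by (simp add: z_def)
  have z_system: "R_system lam mu q R0 (real (m + 1)) xhat z"
    and z_sojourn: "sojourn (m + 1) (\<lambda>j. lam * join_prob xhat (j + 1)) (R_departure xhat) mu q
      (\<lambda>i j. R0 - z i j)"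
    unfolding z_def using R_payoff_never_renege[OF x] by blast+
  \<comment> \<open>The thresholds \<open>xhat\<close> and \<open>m + 1\<close> of the tagged customer differ only at position \<open>m + 1\<close>, where
      the coefficient multiplies \<open>z (m + 1) (m + 1) = 0\<close>.\<close>
  have "R_succ q R0 xhat xhat z i j = R_succ q R0 (real (m + 1)) xhat z i j"
    if "(i, j) \<in> states (m + 1)" for i j
  proof (cases "j = m + 1")
    case True
    then show ?thesis using z_top by (simp add: R_succ_def)
  next
    case False
    then show ?thesis using that jp[of j] unfolding R_succ_def join_prob_nat by simp
  qed
  then have "R_system lam mu q R0 xhat xhat z"
    using z_system by (auto simp: R_system_def fl)
  then have z: "R_payoff lam mu q R0 xhat xhat = z" by (rule R_payoff_eq[OF x])

  interpret V: tagged_queue "m + 1" "\<lambda>j. lam * join_prob xhat (j + 1)" "R_departure xhat" mu q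
    by (rule R_queue[OF x])
  have payoff_less: "z i i < N_payoff lam mu q R0 (real m) i i" if "1 \<le> i" "i \<le> m" for i
  proof -
    have "N_time lam mu q (real m) i i < R0 - z i i"
      by (rule blocking_shortens_sojourn[OF N_time_capped V.tagged_queue_axioms z_sojourn])
        (use that k lam_pos in \<open>auto simp: jp\<close>)
    then show ?thesis by (simp add: N_payoff_def)
  qed
  have z_pos: "0 < z i i" if "1 \<le> i" "i \<le> m" for i
    using \<open>i \<le> m\<close> \<open>1 \<le> i\<close>
  proof (induction rule: inc_induct)
    case base
    have "z (m + 1) (m + 1) + 1 / mu \<le> z m m"
      using V.sojourn_diagonal_gap[OF z_sojourn, of m] base by simp
    moreover have "0 < 1 / mu" using mu_pos by simp
    ultimately show ?case using z_top by linarith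
  next
    case (step n)
    have "z (n + 1) (n + 1) + 1 / mu \<le> z n n"
      using V.sojourn_diagonal_gap[OF z_sojourn, of n] step by simp
    moreover have "0 < 1 / mu" using mu_pos by simp
    moreover have "0 < z (n + 1) (n + 1)" using step by simp
    ultimately show ?case by linarith
  qed

  define bN where "bN = (\<lambda>j. lam * join_prob (real m) (j + 1))"
  define bR where "bR = (\<lambda>j. lam * join_prob xhat (j + 1))"
  define dN where "dN = (\<lambda>_::nat. mu * q)"
  define dR where "dR = (\<lambda>j. mu * q + mu * (1 - q) * (1 - join_prob xhat j))"
  define hN where "hN = bd_weight bN dN"
  define hR where "hR = bd_weight bR dR"
  define SN where "SN = (\<Sum>k\<le>m. hN k)"
  define SR where "SR = (\<Sum>k\<le>m+1. hR k)"
  have dN_pos: "0 < dN j" for j using mu_pos q_pos by (simp add: dN_def)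
  have dR_pos: "0 < dR j" for j
    using mu_pos q_pos q_less join_prob_bounds[of xhat j] by (simp add: dR_def add_pos_nonneg)
  have N_eq: "N_stationary lam mu q (real m) = (\<lambda>j. hN j / SN)"
    unfolding N_stationary_def hN_def SN_def bN_def[symmetric] dN_def[symmetric]
    by (rule stationary_bd_eq) (use lam_pos dN_pos in \<open>auto simp: bN_def\<close>)
  have R_eq: "R_stationary lam mu q xhat = (\<lambda>j. hR j / SR)"
    unfolding R_stationary_def hR_def SR_def bR_def[symmetric] dR_def[symmetric]
    by (rule stationary_bd_eq)
      (use lam_pos dR_pos x in \<open>auto simp: bR_def jp\<close>)
  have h_eq: "hR j = hN j" if "j \<le> m" for j
    unfolding hR_def hN_def bd_weight_def
    using that by (intro prod.cong) (auto simp: bR_def bN_def dR_def dN_def jp)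
  have hN_pos: "0 < hN j" if "j \<le> m" for j
    unfolding hN_def bd_weight_def
    using that lam_pos dN_pos by (intro prod_pos divide_pos_pos) (auto simp: bN_def)
  have bR_pos: "0 < bR j" if "j \<le> m" for j
    using that lam_pos k by (auto simp: bR_def jp)
  have hR_pos: "0 < hR (m + 1)"
    unfolding hR_def bd_weight_def
    using bR_pos dR_pos by (intro prod_pos divide_pos_pos) auto
  have "SR = SN + hR (m + 1)"
    unfolding SR_def SN_def using h_eq by simp
  then have S_less: "SN < SR" using hR_pos by simp
  have SN_pos: "0 < SN" unfolding SN_def using hN_pos by (intro sum_pos) auto

  have "(\<Sum>i=1..m+1. R_stationary lam mu q xhat (i - 1) * z i i)
      = (\<Sum>i=1..m. hN (i - 1) / SR * z i i)"
    using z_top h_eq by (auto simp: R_eq intro!: sum.cong h_eq)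
  also have "\<dots> < (\<Sum>i=1..m. hN (i - 1) / SN * N_payoff lam mu q R0 (real m) i i)"
  proof (rule sum_strict_mono)
    fix i assume "i \<in> {1..m}"
    then have i: "1 \<le> i" "i \<le> m" by auto
    have "hN (i - 1) / SR < hN (i - 1) / SN"
      using hN_pos[of "i - 1"] i S_less SN_pos by (intro divide_strict_left_mono) auto
    then show "hN (i - 1) / SR * z i i < hN (i - 1) / SN * N_payoff lam mu q R0 (real m) i i"
      using payoff_less[OF i] z_pos[OF i] hN_pos[of "i - 1"] i SN_pos S_less
      by (intro mult_strict_mono) auto
  qed (use \<open>1 \<le> m\<close> in auto)
  finally show ?thesis using payoff_less by (simp add: z xe N_eq)
qed

end
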